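(* Let $n>1$ be an integer. For all $P,Q\in\mathbb{R}^n$ and $\varepsilon>0$ let $T_{PQ}(\varepsilon)$ be a fixed finite set with $\{P,Q\}\subseteq T_{PQ}(\varepsilon)\subseteq\mathbb{R}^n$ such that every unit distance preserving map $f:T_{PQ}(\varepsilon)\to\mathbb{R}^n$ satisfies $|d(f(P),f(Q))-d(P,Q)|\le\varepsilon$. (1) If $X,Y\in\mathbb{R}^n$ and a set $S_{XY}$ with $\{X,Y\}\subseteq S_{XY}\subseteq\mathbb{R}^n$ satisfies property $(w\ast)$ for $X,Y$, then the set $$\widetilde{S}_{XY}:=S_{XY}\cup\bigcup_{P,Q\in S_{XY},\,P\neq Q}T_{PQ}\left(\frac{d(P,Q)}{2}\right)\cup\bigcup_{P,Q\in S_{XY},\,d(P,Q)\neq 1}T_{PQ}\left(\frac{|d(P,Q)-1|}{2}\right)$$ satisfies property $(\ast)$ for $X,Y$. Consequently, if $X,Y\in\mathbb{R}^n$ and $d(X,Y)$ is an algebraic number, then there exists a finite set $S$ with $\{X,Y\}\subseteq S\subseteq\mathbb{R}^n$ satisfying $(\ast)$ for $X,Y$. (2) If $K,L,M,N\in\mathbb{R}^n$ and a set $C_{KLMN}$ with $\{K,L,M,N\}\subseteq C_{KLMN}\subseteq\mathbb{R}^n$ satisfies property $(w\diamond)$ for $K,L,M,N$, then the set $$\widetilde{C}_{KLMN}:=C_{KLMN}\cup\bigcup_{P,Q\in C_{KLMN},\,P\neq Q}T_{PQ}\left(\frac{d(P,Q)}{2}\right)\cup\bigcup_{P,Q\in C_{KLMN},\,d(P,Q)\neq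 1}T_{PQ}\left(\frac{|d(P,Q)-1|}{2}\right)$$ satisfies property $(\diamond)$ for $K,L,M,N$. Consequently, if $K,L,M,N\in\mathbb{R}^n$ and $d(K,L)=d(M,N)$, then there exists a finite set $C$ with $\{K,L,M,N\}\subseteq C\subseteq\mathbb{R}^n$ satisfying $(\diamond)$ for $K,L,M,N$.
   Context: $d$ denotes the Euclidean distance on $\mathbb{R}^n$. For $A\subseteq\mathbb{R}^n$, a map $f:A\to\mathbb{R}^n$ is unit distance preserving (preserves unit distance) if for all $P,Q\in A$, $d(P,Q)=1$ implies $d(f(P),f(Q))=1$. The existence, for all $P,Q\in\mathbb{R}^n$ and $\varepsilon>0$, of a finite set $T_{PQ}(\varepsilon)$ with the property stated in the claim is a previously known result (A. Tyszka, Discrete versions of the Beckman-Quarles theorem, Aequationes Math. 59 (2000)). Properties of a set $S$ with $\{X,Y\}\subseteq S\subseteq\mathbb{R}^n$: $(\ast)$ for $X,Y$: every map $f:S\to\mathbb{R}^n$ that preserves unit distance satisfies $d(f(X),f(Y))=d(X,Y)$. $(w\ast)$ for $X,Y$: every injective map $f:S\to\mathbb{R}^n$ such that for all $P,Q\in S$, $d(P,Q)=1\Leftrightarrow d(f(P),f(Q))=1$, satisfies $d(f(X),f(Y))=d(X,Y)$. Properties of a set $C$ with $\{K,L,M,N\}\subseteq C\subseteq\mathbb{R}^n$: $(\diamond)$ for $K,L,M,N$: every map $f:C\to\mathbb{R}^n$ that preserves unit distance satisfies $d(f(K),f(L))=d(f(M),f(N))$. $(w\diamond)$ for $K,L,M,N$: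 every injective map $f:C\to\mathbb{R}^n$ such that for all $P,Q\in C$, $d(P,Q)=1\Leftrightarrow d(f(P),f(Q))=1$, satisfies $d(f(K),f(L))=d(f(M),f(N))$. The following results of R. M. Robinson (Binary relations as primitive notions in elementary geometry, 1959) are known. Let $\mathcal{L}$ be the first-order language with equality whose only non-logical symbol is a binary predicate $P_1$, where $P_1(x,y)$ is interpreted as "$d(x,y)=1$". A relation on $\mathbb{R}^n$ is existentially definable in terms of the unit distance if it is defined in $\mathbb{R}^n$ by an existential $\mathcal{L}$-formula. (i) For every algebraic $r>0$ the relation $d(x,y)=r$ is existentially definable in terms of the unit distance. (ii) For all algebraic numbers $r,s$ with $0<s<r$, the relation "$s\le d(K,L)=d(M,N)$ and $d(K,L),d(K,M),d(K,N),d(L,M),d(L,N),d(M,N)\le r$" is existentially definable in terms of the unit distance. By (i), if $d(X,Y)$ is algebraic there is a finite set satisfying $(w\ast)$ for $X,Y$; by (ii), if $d(K,L)=d(M,N)$ there is a finite set satisfying $(w\diamond)$ for $K,L,M,N$. *)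

theory Defs
  imports "HOL-Analysis.Analysis" "HOL-Computational_Algebra.Polynomial"
begin

text \<open>A map from a subset \<open>A\<close> of the space into the space is rendered as a total function
  of which only the values on \<open>A\<close> are ever used.\<close>

definition unit_dist_preserving_on :: "'a::metric_space set \<Rightarrow> ('a \<Rightarrow> 'a) \<Rightarrow> bool" where
  "unit_dist_preserving_on A f \<longleftrightarrow>
     (\<forall>P\<in>A. \<forall>Q\<in>A. dist P Q = 1 \<longrightarrow> dist (f P) (f Q) = 1)"

definition unit_dist_iff_on :: "'a::metric_space set \<Rightarrow> ('a \<Rightarrow> 'a) \<Rightarrow> bool" where
  "unit_dist_iff_on A f \<longleftrightarrow>
     (\<forall>P\<in>A. \<forall>Q\<in>A. dist P Q = 1 \<longleftrightarrow> dist (f P) (f Q) = 1)"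

text \<open>In the four properties below the distinguished points are meant to lie in the set;
  this is always stated separately.\<close>

definition star :: "'a::metric_space set \<Rightarrow> 'a \<Rightarrow> 'a \<Rightarrow> bool" where
  "star S X Y \<longleftrightarrow>
     (\<forall>f. unit_dist_preserving_on S f \<longrightarrow> dist (f X) (f Y) = dist X Y)"

definition weak_star :: "'a::metric_space set \<Rightarrow> 'a \<Rightarrow> 'a \<Rightarrow> bool" where
  "weak_star S X Y \<longleftrightarrow>
     (\<forall>f. inj_on f S \<and> unit_dist_iff_on S f \<longrightarrow> dist (f X) (f Y) = dist X Y)"

definition diamond :: "'a::metric_space set \<Rightarrow> 'a \<Rightarrow> 'a \<Rightarrow> 'a \<Rightarrow> 'a \<Rightarrow> bool" where
  "diamond C K L M N \<longleftrightarrow>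
     (\<forall>f. unit_dist_preserving_on C f \<longrightarrow> dist (f K) (f L) = dist (f M) (f N))"

definition weak_diamond :: "'a::metric_space set \<Rightarrow> 'a \<Rightarrow> 'a \<Rightarrow> 'a \<Rightarrow> 'a \<Rightarrow> bool" where
  "weak_diamond C K L M N \<longleftrightarrow>
     (\<forall>f. inj_on f C \<and> unit_dist_iff_on C f \<longrightarrow> dist (f K) (f L) = dist (f M) (f N))"

definition tilde :: "('a::metric_space \<Rightarrow> 'a \<Rightarrow> real \<Rightarrow> 'a set) \<Rightarrow> 'a set \<Rightarrow> 'a set" where
  "tilde T S =
     S \<union> (\<Union>(P, Q) \<in> {(P, Q). P \<in> S \<and> Q \<in> S \<and> P \<noteq> Q}. T P Q (dist P Q / 2))
       \<union> (\<Union>(P, Q) \<in> {(P, Q). P \<in> S \<and> Q \<in> S \<and> dist P Q \<noteq> 1}. T P Q (\<bar>dist P Q - 1\<bar> / 2))"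

end

theory Submission
  imports Defs
begin

text \<open>
  Call a property of maps eventual if it holds for all maps preserving unit distance on some
  finite set. Along the resulting filter, the given sets \<open>T\<close> say that \<open>dist (f P) (f Q)\<close> converges
  to \<open>dist P Q\<close>, so discrete ambiguities of a linkage are eventually resolved as in the original
  configuration. Peaucellier cells with legs \<open>1\<close> and \<open>h = sqrt (2 + 2 / n)\<close> (twice the height of
  the regular unit simplex) force half-turns, hence \<open>v \<mapsto> f v - f 0\<close> is eventually additive, and it
  commutes with the inversion \<open>v \<mapsto> v / \<bar>v\<bar>\<^sup>2\<close>. Inversion exchanges spheres through the
  origin with hyperplanes, which gives preservation of orthogonality to unit vectors; by Hua's identity
  all coordinates are transformed by one and the same ring homomorphism \<open>g\<close>, eventually on any
  finite set of relations. Thus \<open>\<bar>f X - f Y\<bar>\<^sup>2 = g (\<bar>X - Y\<bar>\<^sup>2)\<close>, which depends on the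
  distance only, and \<open>g x = x\<close> for algebraic \<open>x\<close>, since \<open>g x\<close> is a root of the
  same polynomial close to \<open>x\<close>.
\<close>

section \<open>Simplices, hyperplanes and inversion in Euclidean space\<close>

text \<open>The standard basis vectors form a regular simplex; removing their components along the
  diagonal \<open>u\<close> centres it in the hyperplane orthogonal to \<open>u\<close>, and an
  orthogonal map takes \<open>u\<close> to \<open>w\<close>.\<close>

lemma regular_simplex_perpendicular:
  fixes w :: "real ^ 'n"
  assumes n: "CARD('n) > 1" and w: "norm w = 1" and \<rho>: "\<rho> > 0"
  obtains b :: "'n \<Rightarrow> real ^ 'n"
  where "\<And>i. b i \<bullet> w = 0" "\<And>i. norm (b i) = \<rho>"
    "\<And>i j. i \<noteq> j \<Longrightarrow> (dist (b i) (b j))\<^sup>2 = 2 * \<rho>\<^sup>2 * CARD('n) / (CARD('n) - 1)"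
proof -
  define N where "N = real CARD('n)"
  have N: "N > 1" using n by (simp add: N_def)
  define k where "k = 1 / sqrt N"
  have kk: "k * k = 1 / N" using N by (simp add: k_def)
  define u :: "real ^ 'n" where "u = (\<chi> i. k)"
  have uu: "u \<bullet> u = 1" using N kk
    by (simp add: u_def inner_vec_def N_def)
  then have "norm u = norm w" by (simp add: w norm_eq_1)
  then obtain U where U: "orthogonal_transformation U" "U u = w"
    by (rule orthogonal_transformation_exists)
  have lin: "linear U" and Uin: "\<And>x y. U x \<bullet> U y = x \<bullet> y"
    using U(1) by (auto simp: orthogonal_transformation_def)
  \<comment> \<open>The vectors \<open>c i\<close> below have squared norm \<open>1 - 1 / N\<close>;
    the factor \<open>\<mu>\<close> brings them to norm \<open>\<rho>\<close>.\<close>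
  define \<mu> where "\<mu> = \<rho> * sqrt (N / (N - 1))"
  have \<mu>2: "\<mu>\<^sup>2 = \<rho>\<^sup>2 * (N / (N - 1))" using N by (simp add: \<mu>_def power_mult_distrib)
  define c :: "'n \<Rightarrow> real ^ 'n" where "c i = axis i 1 - k *\<^sub>R u" for i
  have au: "axis i 1 \<bullet> u = k" for i :: 'n
    by (simp add: inner_axis' u_def)
  then have ua: "u \<bullet> axis i 1 = k" for i :: 'n
    by (metis inner_commute)
  have aa: "axis i 1 \<bullet> (axis j 1 :: real ^ 'n) = (if i = j then 1 else 0)" for i j :: 'n
    by (simp add: inner_axis_axis)
  have cu: "c i \<bullet> u = 0" for i
    by (simp add: c_def inner_diff_left au uu)
  have cc: "c i \<bullet> c i = 1 - 1 / N" for i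
    by (simp add: c_def inner_diff_left inner_diff_right au ua uu aa kk)
  show ?thesis
  proof (rule that[of "\<lambda>i. \<mu> *\<^sub>R U (c i)"])
    show "(\<mu> *\<^sub>R U (c i)) \<bullet> w = 0" for i
      using Uin[of "c i" u] cu[of i] U(2) by simp
    have "(norm (\<mu> *\<^sub>R U (c i)))\<^sup>2 = \<rho>\<^sup>2" for i
    proof -
      have "(norm (\<mu> *\<^sub>R U (c i)))\<^sup>2 = \<mu>\<^sup>2 * (1 - 1 / N)"
        by (simp add: power2_norm_eq_inner Uin cc power2_eq_square[of \<mu>] del: norm_scaleR)
      also have "\<dots> = \<rho>\<^sup>2" using N by (simp add: \<mu>2 field_simps)
      finally show ?thesis .
    qed
    then show "norm (\<mu> *\<^sub>R U (c i)) = \<rho>" for i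
      using \<rho> by (metis norm_ge_zero less_imp_le power2_eq_imp_eq)
    show "(dist (\<mu> *\<^sub>R U (c i)) (\<mu> *\<^sub>R U (c j)))\<^sup>2 = 2 * \<rho>\<^sup>2 * CARD('n) / (CARD('n) - 1)"
      if ij: "i \<noteq> j" for i j
    proof -
      have "\<mu> *\<^sub>R U (c i) - \<mu> *\<^sub>R U (c j) = \<mu> *\<^sub>R U (axis i 1 - axis j 1)"
        by (simp add: c_def linear_diff[OF lin] scaleR_diff_right)
      then have "(dist (\<mu> *\<^sub>R U (c i)) (\<mu> *\<^sub>R U (c j)))\<^sup>2 =
          \<mu>\<^sup>2 * ((axis i 1 - axis j 1) \<bullet> (axis i 1 - axis j 1 :: real ^ 'n))"
        by (simp add: dist_norm power2_norm_eq_inner Uin power2_eq_square[of \<mu>] del: norm_scaleR)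
      also have "\<dots> = \<mu>\<^sup>2 * 2"
        using ij by (simp add: inner_diff_left inner_diff_right aa)
      finally show ?thesis using n by (simp add: \<mu>2 N_def of_nat_diff)
    qed
  qed
qed

text \<open>For an affine dependency with weights \<open>c\<close>, the sum of all
  \<open>c i * c j * (dist (b i) (b j))\<^sup>2\<close> vanishes. Equal squared edges
  \<open>L\<close> would make it \<open>- L\<close> times the sum of the squared weights, and
  deviations of at most \<open>L / (2 * CARD('n))\<close> offset at most half of that. So a slightly
  distorted regular simplex stays nondegenerate.\<close>

lemma near_regular_affine_independent:
  fixes b :: "'n::finite \<Rightarrow> 'a::real_inner"
  assumes L: "L > 0"
    and d: "\<And>i j. i \<noteq> j \<Longrightarrow> \<bar>(dist (b i) (b j))\<^sup>2 - L\<bar> \<le> L / (2 * CARD('n))"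
  shows "inj b" "\<not> affine_dependent (range b)"
proof -
  define N where "N = real CARD('n)"
  have N: "N \<ge> 1" by (simp add: N_def Suc_leI)
  have LN: "L / (2 * N) < L" using L N by (simp add: field_simps)
  show inj: "inj b"
  proof (rule injI, rule ccontr)
    fix i j assume "b i = b j" "i \<noteq> j"
    then show False using d[of i j] LN L by (simp add: N_def)
  qed
  show "\<not> affine_dependent (range b)"
  proof
    assume "affine_dependent (range b)"
    then obtain V where V: "sum V (range b) = 0" "\<exists>v\<in>range b. V v \<noteq> 0"
      "(\<Sum>v\<in>range b. V v *\<^sub>R v) = 0"
      by (auto simp: affine_dependent_explicit_finite)
    define c where "c i = V (b i)" for i
    have c0: "(\<Sum>i\<in>UNIV. c i) = 0"
      using V(1) inj by (simp add: sum.reindex c_def o_def)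
    have cb: "(\<Sum>i\<in>UNIV. c i *\<^sub>R b i) = 0"
      using V(3) inj by (simp add: sum.reindex c_def o_def)
    obtain k where k: "c k \<noteq> 0" using V(2) by (auto simp: c_def)
    \<comment> \<open>The deviation of the matrix of squared distances from that of a regular
      simplex.\<close>
    define e where "e i j = (dist (b i) (b j))\<^sup>2 - (if i = j then 0 else L)" for i j
    have e: "\<bar>e i j\<bar> \<le> L / (2 * N)" for i j
      using d[of i j] L N by (simp add: e_def N_def)
    have "(\<Sum>i\<in>UNIV. \<Sum>j\<in>UNIV. c i * c j * (dist (b i) (b j))\<^sup>2)
        = (\<Sum>i\<in>UNIV. \<Sum>j\<in>UNIV. c j * (c i * (b i \<bullet> b i)) + c i * (c j * (b j \<bullet> b j))
             - 2 * ((c i *\<^sub>R b i) \<bullet> (c j *\<^sub>R b j)))"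
      by (intro sum.cong refl) (simp add: dist_norm power2_norm_eq_inner inner_diff_left
          inner_diff_right inner_commute algebra_simps)
    also have "\<dots> = 0"
    proof -
      have 1: "(\<Sum>i\<in>UNIV. \<Sum>j\<in>UNIV. c j * (c i * (b i \<bullet> b i))) = 0"
        using c0 by (simp flip: sum_distrib_right)
      have 2: "(\<Sum>i\<in>UNIV. \<Sum>j\<in>UNIV. c i * (c j * (b j \<bullet> b j))) = 0"
        unfolding sum_product[symmetric] c0 by simp
      have "(\<Sum>i\<in>UNIV. \<Sum>j\<in>UNIV. (c i *\<^sub>R b i) \<bullet> (c j *\<^sub>R b j))
          = (\<Sum>i\<in>UNIV. c i *\<^sub>R b i) \<bullet> (\<Sum>j\<in>UNIV. c j *\<^sub>R b j)"
        unfolding inner_sum_left inner_sum_right by (rule sum.swap)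
      then have 3: "(\<Sum>i\<in>UNIV. \<Sum>j\<in>UNIV. 2 * ((c i *\<^sub>R b i) \<bullet> (c j *\<^sub>R b j))) = 0"
        by (simp only: sum_distrib_left[symmetric] cb) simp
      show ?thesis unfolding sum.distrib sum_subtractf 1 2 3 by simp
    qed
    finally have z: "(\<Sum>i\<in>UNIV. \<Sum>j\<in>UNIV. c i * c j * (dist (b i) (b j))\<^sup>2) = 0" .
    have split: "c i * c j * (dist (b i) (b j))\<^sup>2 = c i * c j * e i j + L * (c i * c j)
         - (if i = j then L * (c i * c i) else 0)" for i j
      by (cases "i = j") (simp_all add: e_def right_diff_distrib)
    have "(\<Sum>i\<in>UNIV. \<Sum>j\<in>UNIV. L * (c i * c j)) = 0"
      by (simp only: sum_distrib_left[symmetric] sum_product[symmetric] c0) simp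
    then have eq: "(\<Sum>i\<in>UNIV. L * (c i * c i)) = (\<Sum>i\<in>UNIV. \<Sum>j\<in>UNIV. c i * c j * e i j)"
      using z unfolding split sum.distrib sum_subtractf by simp
    have "c i * c j * e i j \<le> ((c i)\<^sup>2 + (c j)\<^sup>2) / 2 * (L / (2 * N))" for i j
    proof -
      have "c i * c j * e i j \<le> \<bar>c i * c j\<bar> * \<bar>e i j\<bar>"
        by (metis abs_ge_self abs_mult)
      also have "\<dots> \<le> ((c i)\<^sup>2 + (c j)\<^sup>2) / 2 * (L / (2 * N))"
      proof (rule mult_mono)
        show "\<bar>c i * c j\<bar> \<le> ((c i)\<^sup>2 + (c j)\<^sup>2) / 2"
          using sum_squares_bound[of "\<bar>c i\<bar>" "\<bar>c j\<bar>"] by (simp add: abs_mult)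
      qed (use e in auto)
      finally show ?thesis .
    qed
    then have "(\<Sum>i\<in>UNIV. \<Sum>j\<in>UNIV. c i * c j * e i j)
       \<le> (\<Sum>i\<in>UNIV. \<Sum>j\<in>UNIV. ((c i)\<^sup>2 + (c j)\<^sup>2) / 2 * (L / (2 * N)))"
      by (intro sum_mono) auto
    also have "\<dots> = (L / (4 * N)) * (\<Sum>i\<in>UNIV. \<Sum>j\<in>(UNIV::'n set). (c i)\<^sup>2 + (c j)\<^sup>2)"
      unfolding sum_distrib_left by (intro sum.cong refl) (simp add: field_simps)
    also have "\<dots> = (L / (4 * N)) * (N * (\<Sum>i\<in>UNIV. (c i)\<^sup>2) + N * (\<Sum>i\<in>UNIV. (c i)\<^sup>2))"
      by (simp add: sum.distrib N_def sum_distrib_left)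
    also have "\<dots> = L / 2 * (\<Sum>i\<in>UNIV. (c i)\<^sup>2)"
      using N by (simp add: field_simps)
    finally have "L * (\<Sum>i\<in>UNIV. (c i)\<^sup>2) \<le> L / 2 * (\<Sum>i\<in>UNIV. (c i)\<^sup>2)"
      using eq by (simp add: sum_distrib_left power2_eq_square)
    then have "(\<Sum>i\<in>UNIV. (c i)\<^sup>2) \<le> 0" using L by (simp add: field_simps)
    then show False using k
      by (metis (no_types, lifting) UNIV_I finite power_eq_0_iff sum_nonneg sum_nonneg_eq_0_iff
          zero_le_power2 dual_order.antisym)
  qed
qed

text \<open>As many affinely independent points as the dimension span a hyperplane, and the vectors
  normal to a hyperplane form a line.\<close>

lemma perpendicular_to_hyperplane_parallel:
  fixes b :: "'n::finite \<Rightarrow> 'a::euclidean_space"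
  assumes card: "CARD('n) = DIM('a)" and inj: "inj b" and ind: "\<not> affine_dependent (range b)"
    and p: "\<And>i j. p \<bullet> (b i - b j) = 0" and q: "\<And>i j. q \<bullet> (b i - b j) = 0" and q0: "q \<noteq> 0"
  obtains t where "p = t *\<^sub>R q"
proof -
  obtain k :: 'n where True by simp
  let ?D = "(\<lambda>x. x - b k) ` range b"
  let ?C = "{y \<in> UNIV. \<forall>x\<in>span ?D. orthogonal x y}"
  have "DIM('a) = dim ?D + 1"
    using affine_independent_card_dim_diffs[OF ind, of "b k"] inj
    by (simp add: card_image card)
  moreover have "dim ?C + dim (span ?D) = dim (UNIV :: 'a set)"
    by (rule dim_subspace_orthogonal_to_vectors) auto
  ultimately have dim: "dim ?C = 1" by simp
  have mem: "v \<in> ?C" if "\<And>i j. v \<bullet> (b i - b j) = 0" for v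
  proof -
    have "orthogonal v x" if "x \<in> span ?D" for x
      using that \<open>\<And>i j. v \<bullet> (b i - b j) = 0\<close> by (intro orthogonal_to_span[of x ?D]) (auto simp: orthogonal_def)
    then show ?thesis by (auto simp: orthogonal_commute)
  qed
  have qC: "{q} \<subseteq> ?C" and pC: "p \<in> ?C" using mem p q by auto
  \<comment> \<open>The nonzero \<open>q\<close> alone is an independent subset of the
    one-dimensional space \<open>?C\<close>, hence spans it.\<close>
  have "?C \<subseteq> span {q}"
    by (rule card_ge_dim_independent[OF qC]) (use q0 dim in auto)
  with pC show ?thesis using that by (auto simp: span_singleton)
qed

text \<open>With \<open>P\<close> as origin, \<open>A\<close> and \<open>C\<close> lie on the line
  of points equidistant from all \<open>b i\<close>. Being at distance \<open>s\<close> from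
  \<open>b i\<close> is a quadratic equation for the position on this line; \<open>A\<close> and
  \<open>C\<close> are its two different roots, and the product of the roots is
  \<open>r\<^sup>2 - s\<^sup>2\<close>.\<close>

lemma peaucellier_inversion:
  fixes b :: "'n::finite \<Rightarrow> 'a::euclidean_space"
  assumes card: "CARD('n) = DIM('a)" and inj: "inj b" and ind: "\<not> affine_dependent (range b)"
    and P: "\<And>i. dist P (b i) = r" and A: "\<And>i. dist A (b i) = s" and C: "\<And>i. dist C (b i) = s"
    and CP: "C \<noteq> P" and AC: "A \<noteq> C"
  shows "A - P = ((r\<^sup>2 - s\<^sup>2) / (norm (C - P))\<^sup>2) *\<^sub>R (C - P)"
proof -
  define p q where "p = A - P" and "q = C - P"
  define c where "c i = b i - P" for i
  have cc: "c i \<bullet> c i = r\<^sup>2" for i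
    using P[of i] by (simp add: c_def dist_norm norm_minus_commute flip: power2_norm_eq_inner)
  have pc: "p \<bullet> p - 2 * (p \<bullet> c i) = s\<^sup>2 - r\<^sup>2" for i
  proof -
    have "(p - c i) \<bullet> (p - c i) = s\<^sup>2"
      using A[of i] by (simp add: p_def c_def dist_norm flip: power2_norm_eq_inner)
    then show ?thesis using cc[of i]
      by (simp add: inner_diff_left inner_diff_right inner_commute)
  qed
  have qc: "q \<bullet> q - 2 * (q \<bullet> c i) = s\<^sup>2 - r\<^sup>2" for i
  proof -
    have "(q - c i) \<bullet> (q - c i) = s\<^sup>2"
      using C[of i] by (simp add: q_def c_def dist_norm flip: power2_norm_eq_inner)
    then show ?thesis using cc[of i]
      by (simp add: inner_diff_left inner_diff_right inner_commute)
  qed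
  have bc: "b i - b j = c i - c j" for i j by (simp add: c_def)
  have "p \<bullet> (b i - b j) = 0" "q \<bullet> (b i - b j) = 0" for i j
    using pc[of i] pc[of j] qc[of i] qc[of j] by (simp_all add: bc inner_diff_right)
  moreover have q0: "q \<noteq> 0" using CP by (simp add: q_def)
  ultimately obtain t where t: "p = t *\<^sub>R q"
    using perpendicular_to_hyperplane_parallel[OF card inj ind] by metis
  have t1: "t \<noteq> 1" using AC t by (auto simp: p_def q_def)
  obtain i :: 'n where True by simp
  have "t * t * (q \<bullet> q) - t * (2 * (q \<bullet> c i)) = s\<^sup>2 - r\<^sup>2"
    using pc[of i] by (simp add: t mult.assoc)
  moreover have "2 * (q \<bullet> c i) = q \<bullet> q + (r\<^sup>2 - s\<^sup>2)" using qc[of i] by simp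
  ultimately have "t * t * (q \<bullet> q) - t * (q \<bullet> q + (r\<^sup>2 - s\<^sup>2)) = s\<^sup>2 - r\<^sup>2"
    by metis
  \<comment> \<open>The root \<open>t = 1\<close> belongs to \<open>C\<close> itself and is split
    off.\<close>
  then have "(t - 1) * (t * (q \<bullet> q) - (r\<^sup>2 - s\<^sup>2)) = 0"
    by (simp add: algebra_simps)
  then have "t * (q \<bullet> q) = r\<^sup>2 - s\<^sup>2" using t1 by simp
  then have "t = (r\<^sup>2 - s\<^sup>2) / (norm q)\<^sup>2" using q0
    by (simp add: power2_norm_eq_inner field_simps)
  then show ?thesis using t by (simp add: p_def q_def)
qed

text \<open>With \<open>X\<close> as origin, the sum \<open>s\<close> of the vertices
  \<open>y i\<close> and the vector \<open>q\<close> to the other apex are both normal to the base,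
  hence parallel. The product \<open>s \<bullet> q\<close> gives the factor \<open>N / 2\<close>,
  and the Gram matrix of the \<open>y i\<close>, with entries 1 and 1/2, gives the length of
  \<open>s\<close>.\<close>

lemma regular_simplex_apexes:
  fixes b :: "'n::finite \<Rightarrow> 'a::euclidean_space"
  assumes card: "CARD('n) = DIM('a)" and inj: "inj b" and ind: "\<not> affine_dependent (range b)"
    and bb: "\<And>i j. i \<noteq> j \<Longrightarrow> dist (b i) (b j) = 1"
    and X: "\<And>i. dist X (b i) = 1" and Y: "\<And>i. dist Y (b i) = 1" and XY: "X \<noteq> Y"
  shows "dist X Y = sqrt (2 + 2 / CARD('n))"
proof -
  define N where "N = real CARD('n)"
  have N: "N \<ge> 1" by (simp add: N_def Suc_leI)
  define q where "q = Y - X"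
  define y where "y i = b i - X" for i
  have dq: "dist X Y = norm q" by (simp add: q_def dist_norm norm_minus_commute)
  have yy: "y i \<bullet> y i = 1" for i
    using X[of i] by (simp add: y_def dist_norm norm_minus_commute flip: power2_norm_eq_inner)
  have yq: "y i \<bullet> q = q \<bullet> q / 2" for i
  proof -
    have "(y i - q) \<bullet> (y i - q) = 1"
      using Y[of i] by (simp add: y_def q_def dist_norm norm_minus_commute flip: power2_norm_eq_inner)
    then show ?thesis using yy[of i]
      by (simp add: inner_diff_left inner_diff_right inner_commute)
  qed
  have yij: "y j \<bullet> y i = 1 / 2 + (if j = i then 1 / 2 else 0)" for i j
  proof (cases "i = j")
    case False
    have "(y j - y i) \<bullet> (y j - y i) = 1"
      using bb[of j i] False by (simp add: y_def dist_norm flip: power2_norm_eq_inner)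
    then show ?thesis using yy[of i] yy[of j] False
      by (simp add: inner_diff_left inner_diff_right inner_commute)
  qed (simp add: yy)
  define s where "s = (\<Sum>j\<in>UNIV. y j)"
  have sy: "s \<bullet> y i = (N + 1) / 2" for i
    unfolding s_def inner_sum_left yij sum.distrib by (simp add: N_def field_simps)
  have ss: "s \<bullet> s = N * ((N + 1) / 2)"
    by (subst (2) s_def) (simp add: inner_sum_right sy N_def)
  have sq: "s \<bullet> q = N * (q \<bullet> q / 2)"
    unfolding s_def inner_sum_left yq by (simp add: N_def)
  have q0: "q \<noteq> 0" using XY by (simp add: q_def)
  have bd: "b i - b j = y i - y j" for i j by (simp add: y_def)
  have sd: "s \<bullet> (b i - b j) = 0" for i j by (simp add: bd inner_diff_right sy)
  have qd: "q \<bullet> (b i - b j) = 0" for i j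
    using yq[of i] yq[of j] by (simp add: bd inner_diff_right inner_commute)
  from perpendicular_to_hyperplane_parallel[OF card inj ind sd qd q0]
  obtain t where t: "s = t *\<^sub>R q" by blast
  have tN: "t = N / 2" using sq q0 by (simp add: t)
  have "N * (N * (q \<bullet> q)) = N * (2 * N + 2)"
    using ss by (simp add: t tN algebra_simps)
  then have "N * (q \<bullet> q) = 2 * N + 2" using N by simp
  then have "q \<bullet> q = 2 + 2 / N"
    using N by (simp add: field_simps)
  then show ?thesis
    by (simp add: dq norm_eq_sqrt_inner N_def)
qed

text \<open>\<open>w\<close> is a diagonal of a rhombus with side \<open>r\<close>; half of the
  other diagonal is \<open>z\<close>, orthogonal to \<open>w\<close>, which takes a second
  dimension.\<close>

lemma sum_of_two_of_norm:
  fixes w :: "'a::euclidean_space"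
  assumes "2 \<le> DIM('a)" and r: "norm w \<le> 2 * r"
  obtains u v where "w = u + v" "norm u = r" "norm v = r"
proof -
  obtain y where y: "y \<noteq> 0" "orthogonal w y"
    using orthogonal_to_vector_exists[OF assms(1)] by blast
  have r0: "0 \<le> r" using r norm_ge_zero[of w] by linarith
  have "(norm w / 2)\<^sup>2 \<le> r\<^sup>2" using r by (intro power_mono) auto
  then have t: "0 \<le> r\<^sup>2 - (norm w / 2)\<^sup>2" by simp
  define z where "z = (sqrt (r\<^sup>2 - (norm w / 2)\<^sup>2) / norm y) *\<^sub>R y"
  have zz: "(norm z)\<^sup>2 = r\<^sup>2 - (norm w / 2)\<^sup>2" using y t by (simp add: z_def)
  have wz: "orthogonal ((1 / 2) *\<^sub>R w) z" "orthogonal ((1 / 2) *\<^sub>R w) (- z)"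
    using y by (auto simp: z_def orthogonal_def)
  have "(norm ((1 / 2) *\<^sub>R w + z))\<^sup>2 = r\<^sup>2" "(norm ((1 / 2) *\<^sub>R w + - z))\<^sup>2 = r\<^sup>2"
    using wz by (simp_all only: norm_add_Pythagorean norm_minus_cancel zz) (simp_all add: power_divide)
  then have "norm ((1 / 2) *\<^sub>R w + z) = r" "norm ((1 / 2) *\<^sub>R w + - z) = r"
    using r0 by (auto intro: power2_eq_imp_eq)
  moreover have "w = ((1 / 2) *\<^sub>R w + z) + ((1 / 2) *\<^sub>R w + - z)"
    by (simp flip: scaleR_add_left)
  ultimately show ?thesis using that by blast
qed

text \<open>\<open>v\<close> is a sum of \<open>n\<close> copies of the short vector
  \<open>u\<close>. For predicates \<open>Q\<close> of the form "eventually" this combines only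
  finitely many eventual facts.\<close>

lemma additive_predicate_everywhere:
  fixes Q :: "'a::real_normed_vector \<Rightarrow> bool"
  assumes add: "\<And>u v. Q u \<Longrightarrow> Q v \<Longrightarrow> Q (u + v)"
    and small: "\<And>v. norm v \<le> \<epsilon> \<Longrightarrow> Q v" and \<epsilon>: "\<epsilon> > 0"
  shows "Q v"
proof -
  obtain n where n: "norm v < real n * \<epsilon>" using reals_Archimedean3[OF \<epsilon>] by blast
  then have n0: "n > 0" using norm_ge_zero[of v] by (cases "n = 0") auto
  define u where "u = (1 / real n) *\<^sub>R v"
  have "Q u" using n n0 by (intro small) (simp add: u_def field_simps)
  have "Q (real k *\<^sub>R u)" for k
  proof (induction k)
    case 0
    then show ?case using small[of 0] \<epsilon> by simp
  next
    case (Suc k)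
    then show ?case using add[OF \<open>Q u\<close>] by (simp add: scaleR_add_left)
  qed
  from this[of n] show ?thesis using n0 by (simp add: u_def)
qed

lemma orthonormal_parseval:
  fixes E :: "'n \<Rightarrow> real ^ 'n"
  assumes "\<And>i j. E i \<bullet> E j = (if i = j then 1 else 0)"
  shows "(norm x)\<^sup>2 = (\<Sum>j\<in>UNIV. (x \<bullet> E j)\<^sup>2)"
proof -
  define A :: "real ^ 'n ^ 'n" where "A = (\<chi> j. E j)"
  have "orthogonal_matrix A"
    using assms by (auto simp: orthogonal_matrix_orthonormal_rows A_def row_def orthogonal_def norm_eq_1)
  then have "orthogonal_transformation (\<lambda>x. A *v x)"
    by (simp add: orthogonal_transformation_matrix)
  then have "(norm x)\<^sup>2 = (norm (A *v x))\<^sup>2" by (simp add: orthogonal_transformation_norm)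
  also have "\<dots> = (\<Sum>j\<in>UNIV. (x \<bullet> E j)\<^sup>2)"
    unfolding power2_norm_eq_inner inner_vec_def[of "A *v x"] matrix_vector_mul_component
    by (simp add: A_def inner_commute power2_eq_square)
  finally show ?thesis .
qed

section \<open>Eventual rigidity of distances\<close>

text \<open>The convergence \<open>lim\<close> is pointwise in the pair \<open>P\<close>,
  \<open>Q\<close>, so the arguments below combine only finitely many pairs at a time.\<close>

locale beckman_quarles_limit =
  fixes F :: "(real ^ 'n \<Rightarrow> real ^ 'n) filter"
  assumes card: "CARD('n) > 1"
    and unit: "\<And>P Q. dist P Q = 1 \<Longrightarrow> \<forall>\<^sub>F f in F. dist (f P) (f Q) = 1"
    and lim: "\<And>P Q. ((\<lambda>f. dist (f P) (f Q)) \<longlongrightarrow> dist P Q) F"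
begin

text \<open>\<open>lim\<close> keeps a distance only approximately; \<open>rigid\<close> asks for
  its exact value, as the bars of a linkage require.\<close>

definition rigid :: "real \<Rightarrow> bool" where
  "rigid r \<longleftrightarrow> (\<forall>P Q. dist P Q = r \<longrightarrow> (\<forall>\<^sub>F f in F. dist (f P) (f Q) = r))"

lemma rigidD: "rigid r \<Longrightarrow> dist P Q = r \<Longrightarrow> \<forall>\<^sub>F f in F. dist (f P) (f Q) = r"
  by (auto simp: rigid_def)

lemma rigid_1: "rigid 1"
  by (simp add: rigid_def unit)

lemma eventually_distinct: "P \<noteq> Q \<Longrightarrow> \<forall>\<^sub>F f in F. f P \<noteq> f Q"
  using order_tendstoD(1)[OF lim, of 0 P Q] by (auto elim: eventually_mono)

text \<open>Nondegeneracy is an open condition, so convergence of the distances suffices and the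
  edges may have any positive length.\<close>

lemma eventually_affine_independent:
  assumes L: "L > 0" and b: "\<And>i j :: 'n. i \<noteq> j \<Longrightarrow> (dist (b i) (b j))\<^sup>2 = L"
  shows "\<forall>\<^sub>F f in F. inj (\<lambda>i. f (b i)) \<and> \<not> affine_dependent (range (\<lambda>i. f (b i)))"
proof -
  have "\<forall>\<^sub>F f in F. i \<noteq> j \<longrightarrow> \<bar>(dist (f (b i)) (f (b j)))\<^sup>2 - L\<bar> \<le> L / (2 * CARD('n))" for i j
  proof (cases "i = j")
    case False
    have "((\<lambda>f. (dist (f (b i)) (f (b j)))\<^sup>2) \<longlongrightarrow> (dist (b i) (b j))\<^sup>2) F"
      by (intro tendsto_power lim)
    then have "\<forall>\<^sub>F f in F. dist ((dist (f (b i)) (f (b j)))\<^sup>2) L < L / (2 * CARD('n))"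
      using L unfolding b[OF False] by (intro tendstoD) auto
    then show ?thesis by eventually_elim (simp add: dist_real_def)
  qed auto
  then have "\<forall>\<^sub>F f in F. \<forall>i j. i \<noteq> j \<longrightarrow> \<bar>(dist (f (b i)) (f (b j)))\<^sup>2 - L\<bar> \<le> L / (2 * CARD('n))"
    by (intro eventually_all_finite)
  then show ?thesis
  proof eventually_elim
    case (elim f)
    then show ?case
      using near_regular_affine_independent[OF L, of "\<lambda>i. f (b i)"] by blast
  qed
qed

definition h :: real where "h = sqrt (2 + 2 / CARD('n))"

lemma h2: "h\<^sup>2 = 2 + 2 / CARD('n)"
  by (simp add: h_def add_nonneg_nonneg)

lemma h_bounds: "7 / 5 < h" "h < 9 / 5"
proof -
  have "2 / real CARD('n) \<le> 1" using card by simp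
  moreover have "2 / real CARD('n) > 0" by simp
  ultimately have "(7 / 5)\<^sup>2 < h\<^sup>2" "h\<^sup>2 < (9 / 5)\<^sup>2"
    unfolding h2 by (simp_all only: power2_eq_square)
  moreover have "h \<ge> 0" by (simp add: h_def)
  ultimately show "7 / 5 < h" "h < 9 / 5" using power2_less_imp_less[of "7 / 5" h] power2_less_imp_less[of h "9 / 5"] by simp_all
qed

text \<open>\<open>X\<close> and \<open>Y\<close> are the two apexes over a common base
  \<open>c\<close> of points at mutual distance 1. All these unit distances are kept exactly and the
  base stays nondegenerate; the folded position \<open>f X = f Y\<close> is excluded by convergence,
  which leaves distance \<open>h\<close>.\<close>

lemma rigid_h: "rigid h"
  unfolding rigid_def
proof (intro allI impI)
  fix X Y :: "real ^ 'n"
  assume XY: "dist X Y = h"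
  define N where "N = real CARD('n)"
  have N: "N > 1" using card by (simp add: N_def)
  have h0: "h > 0" using h_bounds by simp
  define w where "w = (1 / h) *\<^sub>R (X - Y)"
  have w: "norm w = 1" using XY h0 by (simp add: w_def dist_norm)
  \<comment> \<open>The circumradius of a regular simplex with \<open>N\<close> vertices and unit
    edges.\<close>
  define \<rho> where "\<rho> = sqrt ((N - 1) / (2 * N))"
  have \<rho>: "\<rho> > 0" and \<rho>2: "\<rho>\<^sup>2 = (N - 1) / (2 * N)" using N by (simp_all add: \<rho>_def)
  obtain b :: "'n \<Rightarrow> real ^ 'n" where b: "\<And>i. b i \<bullet> w = 0" "\<And>i. norm (b i) = \<rho>"
    "\<And>i j. i \<noteq> j \<Longrightarrow> (dist (b i) (b j))\<^sup>2 = 2 * \<rho>\<^sup>2 * CARD('n) / (CARD('n) - 1)"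
    using regular_simplex_perpendicular[OF card w \<rho>] by blast
  define Z where "Z = (1 / 2) *\<^sub>R (X + Y)"
  define c where "c i = Z + b i" for i
  have cc: "dist (c i) (c j) = 1" if "i \<noteq> j" for i j
  proof -
    have "(dist (c i) (c j))\<^sup>2 = 1"
      using b(3)[OF that] N card by (simp add: c_def \<rho>2 N_def of_nat_diff field_simps)
    then show ?thesis by (simp add: power2_eq_1_iff) (metis zero_le_dist neg_0_le_iff_le not_one_le_zero)
  qed
  have "X - Y = h *\<^sub>R w" using h0 by (simp add: w_def)
  then have XZ: "X - Z = (h / 2) *\<^sub>R w" and YZ: "Y - Z = - (h / 2) *\<^sub>R w"
    by (simp_all add: Z_def vec_eq_iff field_simps)
  have one: "dist (Z + t *\<^sub>R w) (c i) = 1" if "t\<^sup>2 = h\<^sup>2 / 4" for t i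
  proof -
    have ww: "w \<bullet> w = 1" using w by (simp add: norm_eq_1)
    have bb: "b i \<bullet> b i = \<rho>\<^sup>2" using b(2)[of i] by (simp flip: power2_norm_eq_inner)
    have "(dist (Z + t *\<^sub>R w) (c i))\<^sup>2 = (t *\<^sub>R w - b i) \<bullet> (t *\<^sub>R w - b i)"
      by (simp add: dist_norm c_def power2_norm_eq_inner)
    also have "\<dots> = t\<^sup>2 + \<rho>\<^sup>2"
      using b(1)[of i] by (simp add: inner_diff_left inner_diff_right bb ww inner_commute[of w "b i"] power2_eq_square)
    also have "\<dots> = 1" using N by (simp add: that \<rho>2 h2 field_simps flip: N_def)
    finally show ?thesis by (simp add: power2_eq_1_iff) (metis zero_le_dist neg_0_le_iff_le not_one_le_zero)
  qed
  have Xc: "dist X (c i) = 1" for i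
    using one[of "h / 2" i] by (simp add: power_divide flip: XZ)
  have Yc: "dist Y (c i) = 1" for i
    using one[of "- (h / 2)" i] unfolding YZ[symmetric] by (simp add: power_divide)
  have "\<forall>\<^sub>F f in F. inj (\<lambda>i. f (c i)) \<and> \<not> affine_dependent (range (\<lambda>i. f (c i)))"
    by (rule eventually_affine_independent[of 1]) (auto simp: cc)
  moreover have "\<forall>\<^sub>F f in F. \<forall>i j. i \<noteq> j \<longrightarrow> dist (f (c i)) (f (c j)) = 1"
  proof (intro eventually_all_finite)
    show "\<forall>\<^sub>F f in F. i \<noteq> j \<longrightarrow> dist (f (c i)) (f (c j)) = 1" for i j
      using unit[OF cc, of i j] by (cases "i = j") auto
  qed
  moreover have "\<forall>\<^sub>F f in F. \<forall>i. dist (f X) (f (c i)) = 1" "\<forall>\<^sub>F f in F. \<forall>i. dist (f Y) (f (c i)) = 1"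
    by (auto intro!: eventually_all_finite unit Xc Yc)
  moreover have "\<forall>\<^sub>F f in F. f X \<noteq> f Y"
    using XY h0 by (intro eventually_distinct) auto
  ultimately show "\<forall>\<^sub>F f in F. dist (f X) (f Y) = h"
  proof eventually_elim
    case (elim f)
    then show ?case
      using regular_simplex_apexes[of "\<lambda>i. f (c i)" "f X" "f Y"] by (simp add: h_def)
  qed
qed

section \<open>Peaucellier cells and half-turns\<close>

text \<open>The cell has joints \<open>B i\<close> at distance \<open>r\<close> from
  \<open>P\<close> and \<open>s\<close> from \<open>A\<close> and \<open>C\<close>. The inequality
  on \<open>c\<close> is the strict triangle inequality for the sides \<open>c\<close>,
  \<open>r\<close>, \<open>s\<close>, so that the joints exist and are distinct; the last condition
  on \<open>c\<close> separates \<open>A\<close> from \<open>C\<close>.\<close>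

lemma eventually_inversion:
  assumes r: "rigid r" "r > 0" and s: "rigid s" "s > 0"
    and c: "c = dist C P" "(c\<^sup>2 + r\<^sup>2 - s\<^sup>2)\<^sup>2 < 4 * r\<^sup>2 * c\<^sup>2" "c\<^sup>2 \<noteq> r\<^sup>2 - s\<^sup>2"
    and A: "A = P + ((r\<^sup>2 - s\<^sup>2) / c\<^sup>2) *\<^sub>R (C - P)"
  shows "\<forall>\<^sub>F f in F. f A - f P = ((r\<^sup>2 - s\<^sup>2) / (dist (f C) (f P))\<^sup>2) *\<^sub>R (f C - f P)"
proof -
  have c0: "c > 0" using c(1,2) by (cases "c = 0") auto
  define k where "k = r\<^sup>2 - s\<^sup>2"
  define w where "w = (1 / c) *\<^sub>R (C - P)"
  have w: "norm w = 1" using c(1) c0 by (simp add: w_def dist_norm)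
  \<comment> \<open>The joints lie in the perpendicular bisector of \<open>A\<close> and
    \<open>C\<close>, whose positions on the axis through \<open>P\<close> with direction
    \<open>w\<close> are \<open>k / c\<close> and \<open>c\<close>.\<close>
  define m where "m = (c + k / c) / 2"
  have m2: "m\<^sup>2 = (c\<^sup>2 + k)\<^sup>2 / (4 * c\<^sup>2)"
    using c0 by (simp add: m_def field_simps power2_eq_square)
  have "m\<^sup>2 < r\<^sup>2"
    using c(2) c0 unfolding m2 by (simp add: k_def field_simps)
  define \<rho> where "\<rho> = sqrt (r\<^sup>2 - m\<^sup>2)"
  have \<rho>: "\<rho> > 0" and \<rho>2: "\<rho>\<^sup>2 = r\<^sup>2 - m\<^sup>2"
    using \<open>m\<^sup>2 < r\<^sup>2\<close> by (simp_all add: \<rho>_def)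
  obtain b :: "'n \<Rightarrow> real ^ 'n" where b: "\<And>i. b i \<bullet> w = 0" "\<And>i. norm (b i) = \<rho>"
    "\<And>i j. i \<noteq> j \<Longrightarrow> (dist (b i) (b j))\<^sup>2 = 2 * \<rho>\<^sup>2 * CARD('n) / (CARD('n) - 1)"
    using regular_simplex_perpendicular[OF card w \<rho>] by blast
  define B where "B i = P + m *\<^sub>R w + b i" for i
  have B: "(dist (P + x *\<^sub>R w) (B i))\<^sup>2 = (m - x)\<^sup>2 + r\<^sup>2 - m\<^sup>2" for x i
  proof -
    have ww: "w \<bullet> w = 1" using w by (simp add: norm_eq_1)
    have bb: "b i \<bullet> b i = \<rho>\<^sup>2" using b(2)[of i] by (simp flip: power2_norm_eq_inner)
    have "P + x *\<^sub>R w - B i = (x - m) *\<^sub>R w - b i"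
      by (simp add: B_def algebra_simps)
    then have "(dist (P + x *\<^sub>R w) (B i))\<^sup>2 = ((x - m) *\<^sub>R w - b i) \<bullet> ((x - m) *\<^sub>R w - b i)"
      by (simp add: dist_norm power2_norm_eq_inner)
    also have "\<dots> = (x - m)\<^sup>2 + \<rho>\<^sup>2"
      using b(1)[of i] by (simp add: inner_diff_left[of _ "b i"] inner_diff_right[of _ _ "b i"]
          bb ww inner_commute[of w "b i"] power2_eq_square)
    finally show ?thesis by (simp add: \<rho>2 power2_commute)
  qed
  have BP: "dist P (B i) = r" for i
    using B[of 0 i] r(2) by (simp add: power2_eq_iff_nonneg)
  have AC: "A = P + (k / c) *\<^sub>R w" "C = P + c *\<^sub>R w"
    using c0 by (simp_all add: A w_def k_def power2_eq_square)
  have "(m - c)\<^sup>2 + r\<^sup>2 - m\<^sup>2 = s\<^sup>2"  "(m - k / c)\<^sup>2 + r\<^sup>2 - m\<^sup>2 = s\<^sup>2"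
    using c0 by (simp_all add: power2_diff m_def k_def) (simp_all add: field_simps power2_eq_square)
  then have BC: "dist C (B i) = s" and BA: "dist A (B i) = s" for i
    using B[of c i] B[of "k / c" i] s(2) by (simp_all add: AC power2_eq_iff_nonneg)
  have "A \<noteq> C"
  proof
    assume "A = C"
    then have "(k / c) *\<^sub>R w = c *\<^sub>R w" by (simp add: AC)
    then have "k / c = c" using w by auto
    then show False using c(3) c0 by (simp add: k_def field_simps power2_eq_square)
  qed
  then have 1: "\<forall>\<^sub>F f in F. f A \<noteq> f C" by (rule eventually_distinct)
  have 2: "\<forall>\<^sub>F f in F. f C \<noteq> f P" using c(1) c0 by (intro eventually_distinct) auto
  have "CARD('n) - 1 > 0" using card by simp
  then have "2 * \<rho>\<^sup>2 * CARD('n) / (CARD('n) - 1) > 0"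
    using \<rho> by (intro divide_pos_pos mult_pos_pos) simp_all
  then have 3: "\<forall>\<^sub>F f in F. inj (\<lambda>i. f (B i)) \<and> \<not> affine_dependent (range (\<lambda>i. f (B i)))"
    by (rule eventually_affine_independent) (use b(3) in \<open>auto simp: B_def\<close>)
  have 4: "\<forall>\<^sub>F f in F. \<forall>i. dist (f P) (f (B i)) = r" "\<forall>\<^sub>F f in F. \<forall>i. dist (f A) (f (B i)) = s"
    "\<forall>\<^sub>F f in F. \<forall>i. dist (f C) (f (B i)) = s"
    by (auto intro!: eventually_all_finite rigidD r s BP BA BC)
  from 1 2 3 4 show ?thesis
  proof eventually_elim
    case (elim f)
    then show ?case
      using peaucellier_inversion[of "\<lambda>i. f (B i)" "f P" r "f A" s "f C"]
      by (simp add: dist_norm)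
  qed
qed

text \<open>Legs \<open>h\<close> at \<open>P\<close> and 1 at the two other corners. Since
  \<open>h\<close> lies between 7/5 and 9/5, this range of distances gives nondegenerate triangles
  with sides \<open>c\<close>, \<open>h\<close>, 1, and \<open>c\<^sup>2 \<ge> 9 / 4\<close> exceeds
  \<open>h\<^sup>2 - 1 \<le> 2\<close>.\<close>

lemma inversion_h_1:
  assumes c: "3 / 2 \<le> dist C P" "dist C P \<le> 2"
  shows "\<forall>\<^sub>F f in F. f (P + ((h\<^sup>2 - 1) / (dist C P)\<^sup>2) *\<^sub>R (C - P)) - f P
           = ((h\<^sup>2 - 1) / (dist (f C) (f P))\<^sup>2) *\<^sub>R (f C - f P)"
proof -
  define c where "c = dist C P"
  have h0: "h > 0" using h_bounds by simp
  have h3: "h\<^sup>2 \<le> 3" using card by (simp add: h2)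
  have cc: "c\<^sup>2 \<ge> 9 / 4"
    using c power_mono[of "3 / 2" c 2] by (simp add: c_def power2_eq_square)
  have "(c - h)\<^sup>2 < 1" using c h_bounds by (simp add: c_def abs_square_less_1 abs_less_iff)
  then have lt: "c\<^sup>2 + h\<^sup>2 - 1\<^sup>2 < 2 * h * c" by (simp add: power2_diff algebra_simps)
  have "0 \<le> c\<^sup>2 + h\<^sup>2 - 1\<^sup>2"
    using cc zero_le_power2[of h] unfolding one_power2 by linarith
  from power_strict_mono[OF lt this, of 2] have i: "(c\<^sup>2 + h\<^sup>2 - 1\<^sup>2)\<^sup>2 < 4 * h\<^sup>2 * c\<^sup>2"
    by (simp add: power_mult_distrib)
  have "c\<^sup>2 \<noteq> h\<^sup>2 - 1\<^sup>2" using h3 cc unfolding one_power2 by linarith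
  from eventually_inversion[OF rigid_h h0 rigid_1 zero_less_one c_def i this refl]
  show ?thesis by (simp add: c_def)
qed

text \<open>Exchanging the legs makes the power of the inversion negative: the inverted point lies
  on the other side of \<open>P\<close> from \<open>C\<close>.\<close>

lemma inversion_1_h:
  assumes c: "3 / 2 \<le> dist C P" "dist C P \<le> 2"
  shows "\<forall>\<^sub>F f in F. f (P - ((h\<^sup>2 - 1) / (dist C P)\<^sup>2) *\<^sub>R (C - P)) - f P
           = - (((h\<^sup>2 - 1) / (dist (f C) (f P))\<^sup>2) *\<^sub>R (f C - f P))"
proof -
  define c where "c = dist C P"
  have h0: "h > 0" using h_bounds by simp
  have h23: "h\<^sup>2 > 2" "h\<^sup>2 \<le> 3" using card by (simp_all add: h2)
  have cc: "c\<^sup>2 \<ge> 9 / 4"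
    using c power_mono[of "3 / 2" c 2] by (simp add: c_def power2_eq_square)
  have "(c - 1)\<^sup>2 \<le> 1" using c by (simp add: abs_square_le_1 c_def abs_le_iff)
  then have lt: "c\<^sup>2 + 1\<^sup>2 - h\<^sup>2 < 2 * 1 * c"
    using h23 by (simp add: power2_diff algebra_simps)
  have "0 \<le> c\<^sup>2 + 1\<^sup>2 - h\<^sup>2" using h23 cc unfolding one_power2 by linarith
  from power_strict_mono[OF lt this, of 2] have i: "(c\<^sup>2 + 1\<^sup>2 - h\<^sup>2)\<^sup>2 < 4 * 1\<^sup>2 * c\<^sup>2"
    by (simp add: power_mult_distrib)
  have "c\<^sup>2 \<noteq> 1\<^sup>2 - h\<^sup>2" using h23 cc unfolding one_power2 by linarith
  moreover have "1\<^sup>2 - h\<^sup>2 = - (h\<^sup>2 - 1)" by simp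
  ultimately show ?thesis
    using eventually_inversion[OF rigid_1 zero_less_one rigid_h h0 c_def i _ refl]
    by (simp only: c_def minus_divide_left[symmetric] scaleR_minus_left diff_conv_add_uminus[of P] simp_thms True_implies_equals)
qed

text \<open>The same point \<open>A\<close> is the inverse of \<open>Z + v\<close> with power
  \<open>k\<close> and of \<open>Z - v\<close> with power \<open>-k\<close>. Both relations persist
  for the images, and inversion is injective.\<close>

lemma half_turn:
  assumes v: "3 / 2 \<le> norm v" "norm v \<le> 2"
  shows "\<forall>\<^sub>F f in F. f (Z + v) - f Z = - (f (Z - v) - f Z)"
proof -
  have v0: "v \<noteq> 0" using v by auto
  define k where "k = h\<^sup>2 - 1"
  have "k > 0" by (simp add: k_def h2 add_pos_nonneg)
  then have k0: "k \<noteq> 0" by simp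
  define A where "A = Z + (k / (norm v)\<^sup>2) *\<^sub>R v"
  have 1: "\<forall>\<^sub>F f in F. f A - f Z = (k / (dist (f (Z + v)) (f Z))\<^sup>2) *\<^sub>R (f (Z + v) - f Z)"
    using inversion_h_1[of "Z + v" Z] v by (simp add: dist_norm A_def flip: k_def)
  have 2: "\<forall>\<^sub>F f in F. f A - f Z = - ((k / (dist (f (Z - v)) (f Z))\<^sup>2) *\<^sub>R (f (Z - v) - f Z))"
    using inversion_1_h[of "Z - v" Z] v v0 by (simp add: dist_norm A_def flip: k_def)
  have 3: "\<forall>\<^sub>F f in F. f (Z + v) \<noteq> f Z" "\<forall>\<^sub>F f in F. f (Z - v) \<noteq> f Z"
    using eventually_distinct[of "Z + v" Z] eventually_distinct[of "Z - v" Z] v0 by simp_all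
  from 1 2 3 show ?thesis
  proof eventually_elim
    case (elim f)
    define x y where "x = f (Z + v) - f Z" and "y = f (Z - v) - f Z"
    have xy: "x \<noteq> 0" "y \<noteq> 0" using elim by (simp_all add: x_def y_def)
    have e: "(k / (norm x)\<^sup>2) *\<^sub>R x = - ((k / (norm y)\<^sup>2) *\<^sub>R y)"
      using elim by (simp add: x_def y_def dist_norm)
    then have "norm ((k / (norm x)\<^sup>2) *\<^sub>R x) = norm ((k / (norm y)\<^sup>2) *\<^sub>R y)" by (simp only: norm_minus_cancel)
    \<comment> \<open>Inversion with power \<open>k\<close> turns length \<open>l\<close> into
      \<open>k / l\<close>, so equal lengths after inversion mean equal lengths before.\<close>
    then have nn: "norm x = norm y" using k0 xy by (simp add: power2_eq_square)
    have "(k / (norm x)\<^sup>2) *\<^sub>R x = (k / (norm x)\<^sup>2) *\<^sub>R (- y)"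
      using e unfolding nn scaleR_minus_right .
    then have "x = - y" using k0 xy by (simp del: scaleR_minus_right)
    then show ?case by (simp add: x_def y_def)
  qed
qed

section \<open>Additivity of displacements\<close>

text \<open>The diagonals of a parallelogram share their midpoint \<open>Z\<close>, and half-turns
  about \<open>Z\<close> exchange opposite vertices. Hence images of parallelograms are
  parallelograms whenever both half-diagonals are in the range of \<open>half_turn\<close>; the
  remaining shapes are composed of such ones.\<close>

lemma eventually_translate:
  "\<forall>\<^sub>F f in F. f (x + v) - f x = f (x + w + v) - f (x + w)"
proof -
  define T where "T v w \<longleftrightarrow> (\<forall>x. \<forall>\<^sub>F f in F. f (x + v) - f x = f (x + w + v) - f (x + w))" for v w
  have sym: "T w v" if "T v w" for v w
    unfolding T_def
  proof
    show "\<forall>\<^sub>F f in F. f (x + w) - f x = f (x + v + w) - f (x + v)" for x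
      using that[unfolded T_def, rule_format, of x]
      by eventually_elim (simp add: algebra_simps)
  qed
  have add: "T v (w + w')" if "T v w" "T v w'" for v w w'
    unfolding T_def
  proof
    show "\<forall>\<^sub>F f in F. f (x + v) - f x = f (x + (w + w') + v) - f (x + (w + w'))" for x
      using that(1)[unfolded T_def, rule_format, of x] that(2)[unfolded T_def, rule_format, of "x + w"]
      by eventually_elim (simp add: add.assoc)
  qed
  \<comment> \<open>These sizes put the diagonals \<open>v + w\<close> and \<open>v - w\<close>
    between \<open>7 / 2 - 1 / 2 = 3\<close> and \<open>7 / 2 + 1 / 2 = 4\<close>.\<close>
  have far: "T v w" if v: "norm v \<le> 1 / 2" and w: "norm w = 7 / 2" for v w
    unfolding T_def
  proof
    fix x
    define Z where "Z = x + (1 / 2) *\<^sub>R (v + w)"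
    have half: "a = (1 / 2) *\<^sub>R a + (1 / 2) *\<^sub>R a" for a :: "real ^ 'n"
      by (simp flip: scaleR_add_left)
    have "norm (v + w) \<le> 4" "norm (v - w) \<le> 4" "3 \<le> norm (v + w)" "3 \<le> norm (v - w)"
      using norm_triangle_ineq[of v w] norm_triangle_ineq4[of v w] norm_diff_ineq[of w v]
        norm_triangle_ineq2[of w v] v w by (simp_all add: add.commute norm_minus_commute)
    then have "\<forall>\<^sub>F f in F. f (Z + (1 / 2) *\<^sub>R (v + w)) - f Z = - (f (Z - (1 / 2) *\<^sub>R (v + w)) - f Z)"
      "\<forall>\<^sub>F f in F. f (Z + (1 / 2) *\<^sub>R (v - w)) - f Z = - (f (Z - (1 / 2) *\<^sub>R (v - w)) - f Z)"
      by (intro half_turn; simp)+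
    moreover have "Z + (1 / 2) *\<^sub>R (v + w) = x + w + v" "Z - (1 / 2) *\<^sub>R (v + w) = x"
      "Z + (1 / 2) *\<^sub>R (v - w) = x + v" "Z - (1 / 2) *\<^sub>R (v - w) = x + w"
      using half[of v] half[of w] by (simp_all add: Z_def algebra_simps)
    ultimately have "\<forall>\<^sub>F f in F. f (x + w + v) - f Z = - (f x - f Z)"
      "\<forall>\<^sub>F f in F. f (x + v) - f Z = - (f (x + w) - f Z)" by simp_all
    then show "\<forall>\<^sub>F f in F. f (x + v) - f x = f (x + w + v) - f (x + w)"
    proof eventually_elim
      case (elim f)
      have "f (x + v) - f x - (f (x + w + v) - f (x + w))
          = (f (x + v) - f Z + (f (x + w) - f Z)) - ((f (x + w + v) - f Z) + (f x - f Z))"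
        by simp
      then show ?case using elim by simp
    qed
  qed
  \<comment> \<open>Every \<open>w\<close> of norm at most 7 is a sum of two vectors of norm 7/2,
    and \<open>T v\<close> is additive.\<close>
  have near: "T v w" if v: "norm v \<le> 1 / 2" for v w
  proof (rule additive_predicate_everywhere[of "T v" 7])
    show "T v w" if w: "norm w \<le> 7" for w
    proof -
      obtain a b where "w = a + b" "norm a = 7 / 2" "norm b = 7 / 2"
        using sum_of_two_of_norm[of w "7 / 2"] w card by auto
      then show ?thesis using add far v by simp
    qed
  qed (auto intro: add)
  \<comment> \<open>By the symmetry of \<open>T\<close>, the restriction on its other argument is
    removed by additivity as well.\<close>
  have "T w v" for v w
  proof (rule additive_predicate_everywhere[of "T w" "1 / 2"])
    show "T w a" if "norm a \<le> 1 / 2" for a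
      by (rule sym[OF near[OF that]])
  qed (auto intro: add)
  then show ?thesis by (simp add: T_def)
qed

definition disp :: "(real ^ 'n \<Rightarrow> real ^ 'n) \<Rightarrow> real ^ 'n \<Rightarrow> real ^ 'n" where
  "disp f v = f v - f 0"

lemma disp_0 [simp]: "disp f 0 = 0"
  by (simp add: disp_def)

lemma disp_add: "\<forall>\<^sub>F f in F. disp f (u + v) = disp f u + disp f v"
  using eventually_translate[of 0 v u] by eventually_elim (simp add: disp_def)

lemma disp_diff: "\<forall>\<^sub>F f in F. disp f (u - v) = disp f u - disp f v"
  using disp_add[of "u - v" v] by eventually_elim simp

lemma dist_eq_norm_disp: "\<forall>\<^sub>F f in F. dist (f X) (f Y) = norm (disp f (X - Y))"
  using disp_diff[of X Y] by eventually_elim (simp add: disp_def dist_norm)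

text \<open>For a fixed rational factor, finitely many instances of additivity suffice after
  clearing the denominator.\<close>

lemma disp_scaleR_rat:
  assumes "q \<in> \<rat>"
  shows "\<forall>\<^sub>F f in F. disp f (q *\<^sub>R v) = q *\<^sub>R disp f v"
proof -
  have nat: "\<forall>\<^sub>F f in F. disp f (real k *\<^sub>R v) = real k *\<^sub>R disp f v" for k v
  proof (induction k)
    case (Suc k)
    then show ?case using disp_add[of v "real k *\<^sub>R v"]
      by eventually_elim (simp add: scaleR_add_left)
  qed simp
  have int: "\<forall>\<^sub>F f in F. disp f (of_int k *\<^sub>R v) = of_int k *\<^sub>R disp f v" for k v
  proof -
    have eq: "real_of_int k = real (nat k) - real (nat (- k))" by simp
    show ?thesis
      using disp_diff[of "real (nat k) *\<^sub>R v" "real (nat (- k)) *\<^sub>R v"] nat[of "nat k" v] nat[of "nat (- k)" v]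
      unfolding eq scaleR_diff_left by eventually_elim simp
  qed
  obtain a b where b: "b > 0" and q: "q = of_int a / of_int b"
    using assms by (elim Rats_cases') auto
  have "of_int b *\<^sub>R q *\<^sub>R v = of_int a *\<^sub>R v" using b by (simp add: q)
  with int[of b "q *\<^sub>R v"] int[of a v] have "\<forall>\<^sub>F f in F. of_int b *\<^sub>R disp f (q *\<^sub>R v) = of_int a *\<^sub>R disp f v"
    by (auto elim: eventually_elim2)
  then show ?thesis
  proof eventually_elim
    case (elim f)
    have "disp f (q *\<^sub>R v) = (1 / of_int b) *\<^sub>R of_int b *\<^sub>R disp f (q *\<^sub>R v)" using b by simp
    also have "\<dots> = q *\<^sub>R disp f v" unfolding elim using b by (simp add: q)
    finally show ?case .
  qed
qed

lemma norm_disp_unit: "norm e = 1 \<Longrightarrow> \<forall>\<^sub>F f in F. norm (disp f e) = 1"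
  using unit[of e 0] by (simp add: disp_def dist_norm)

lemma disp_nonzero: "v \<noteq> 0 \<Longrightarrow> \<forall>\<^sub>F f in F. disp f v \<noteq> 0"
  using eventually_distinct[of v 0] by (simp add: disp_def)

section \<open>Inversion and orthogonality\<close>

text \<open>A rational factor \<open>q\<close> brings the length of \<open>v\<close> into the range
  of \<open>inversion_h_1\<close>. The power \<open>k = 1 + 2 / CARD('n)\<close> is rational too, so
  both factors pass through \<open>disp f\<close> and cancel.\<close>

lemma disp_inversion:
  assumes v: "v \<noteq> 0"
  shows "\<forall>\<^sub>F f in F. disp f ((1 / (norm v)\<^sup>2) *\<^sub>R v) = (1 / (norm (disp f v))\<^sup>2) *\<^sub>R disp f v"
proof -
  have "3 / 2 / norm v < 2 / norm v" using v by (intro divide_strict_right_mono) auto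
  then obtain q where q: "q \<in> \<rat>" "3 / 2 / norm v < q" "q < 2 / norm v"
    using Rats_dense_in_real by blast
  have q0: "q > 0" using q(2) v by (smt (verit) divide_nonneg_nonneg norm_ge_zero)
  define c where "c = norm (q *\<^sub>R v)"
  have c: "3 / 2 < c" "c < 2" using q q0 v by (simp_all add: c_def field_simps)
  define k where "k = h\<^sup>2 - 1"
  have k: "k \<in> \<rat>" "k > 0" by (simp_all add: k_def h2 add_pos_nonneg)
  have eq: "(k / c\<^sup>2) *\<^sub>R q *\<^sub>R v = (k / q) *\<^sub>R (1 / (norm v)\<^sup>2) *\<^sub>R v"
    using q0 by (simp add: c_def power_mult_distrib power2_eq_square[of q])
  have "\<forall>\<^sub>F f in F. f ((k / q) *\<^sub>R (1 / (norm v)\<^sup>2) *\<^sub>R v) - f 0 =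
     (k / (dist (f (q *\<^sub>R v)) (f 0))\<^sup>2) *\<^sub>R (f (q *\<^sub>R v) - f 0)"
    using inversion_h_1[of "q *\<^sub>R v" 0] c unfolding k_def[symmetric] eq[symmetric]
    by (simp only: dist_0_norm dist_commute[of _ "0 :: real ^ 'n"] c_def add_0 diff_zero less_imp_le simp_thms True_implies_equals)
  moreover note disp_scaleR_rat[OF Rats_divide[OF k(1) q(1)], of "(1 / (norm v)\<^sup>2) *\<^sub>R v"]
    disp_scaleR_rat[OF q(1), of v]
  ultimately show ?thesis
  proof eventually_elim
    case (elim f)
    have "(k / q) *\<^sub>R disp f ((1 / (norm v)\<^sup>2) *\<^sub>R v) = (k / (norm (q *\<^sub>R disp f v))\<^sup>2) *\<^sub>R q *\<^sub>R disp f v"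
      using elim unfolding disp_def dist_norm by metis
    also have "\<dots> = (k / q) *\<^sub>R (1 / (norm (disp f v))\<^sup>2) *\<^sub>R disp f v"
      using q0 by (simp add: power_mult_distrib power2_eq_square)
    finally show ?case using k(2) q0 by (metis divide_eq_0_iff less_irrefl scaleR_cancel_left)
  qed
qed

text \<open>Inversion takes the hyperplane of all \<open>C\<close> with
  \<open>C \<bullet> e = 1 / 2\<close> to the unit sphere about \<open>e\<close>, which passes
  through the origin. So orthogonality of \<open>y\<close> to \<open>e\<close> becomes the unit
  distance from \<open>A\<close> to \<open>e\<close>, is preserved there and is translated
  back.\<close>

lemma disp_orthogonal_unit:
  assumes e: "norm e = 1" and y: "y \<bullet> e = 0"
  shows "\<forall>\<^sub>F f in F. disp f y \<bullet> disp f e = 0"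
proof -
  define C where "C = (1 / 2) *\<^sub>R e + y"
  define A where "A = (1 / (norm C)\<^sup>2) *\<^sub>R C"
  have ee: "e \<bullet> e = 1" using e by (simp add: norm_eq_1)
  have Ce: "C \<bullet> e = 1 / 2" using y ee by (simp add: C_def inner_add_left)
  then have C0: "C \<noteq> 0" by auto
  have "(A - e) \<bullet> (A - e) = 1"
    using C0 Ce ee by (simp add: A_def inner_diff_left inner_diff_right inner_commute[of e C]
        power2_norm_eq_inner)
  then have "dist A e = 1" by (simp add: dist_norm norm_eq_1)
  note 1 = unit[OF this]
  have 2: "\<forall>\<^sub>F f in F. disp f A = (1 / (norm (disp f C))\<^sup>2) *\<^sub>R disp f C"
    using disp_inversion[OF C0] by (simp add: A_def)
  have 3: "\<forall>\<^sub>F f in F. disp f ((1 / 2) *\<^sub>R e) = (1 / 2) *\<^sub>R disp f e"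
    by (intro disp_scaleR_rat) auto
  show ?thesis
    using 1 2 3 disp_add[of "(1 / 2) *\<^sub>R e" y, folded C_def] norm_disp_unit[OF e] disp_nonzero[OF C0]
  proof eventually_elim
    case (elim f)
    define a b c where "a = disp f A" and "b = disp f e" and "c = disp f C"
    have ab: "norm (a - b) = 1" using elim(1) by (simp add: a_def b_def disp_def dist_norm)
    have bb: "b \<bullet> b = 1" using elim by (simp add: b_def norm_eq_1)
    have "(a - b) \<bullet> (a - b) = 1" using ab by (simp add: norm_eq_1)
    then have aa: "a \<bullet> a = 2 * (a \<bullet> b)" using bb
      by (simp add: inner_diff_left inner_diff_right inner_commute)
    have ac: "a = (1 / (c \<bullet> c)) *\<^sub>R c" using elim by (simp add: a_def c_def power2_norm_eq_inner)
    have c0: "c \<noteq> 0" using elim by (simp add: c_def)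
    have "c \<bullet> b = 1 / 2" using aa c0 by (simp add: ac)
    moreover have "c = (1 / 2) *\<^sub>R b + disp f y" using elim by (simp add: c_def b_def)
    ultimately have "disp f y \<bullet> b = 0" using bb by (simp add: inner_add_left)
    then show ?case by (simp add: b_def)
  qed
qed

section \<open>The coordinate homomorphism\<close>

text \<open>The map \<open>g\<close> of the overview, at first one for each axis;
  \<open>coord_index\<close> shows that they eventually agree at each \<open>x\<close>.\<close>

definition coord :: "'n \<Rightarrow> (real ^ 'n \<Rightarrow> real ^ 'n) \<Rightarrow> real \<Rightarrow> real" where
  "coord i f x = disp f (x *\<^sub>R axis i 1) \<bullet> disp f (axis i 1)"

lemma norm_axis_1: "norm (axis i 1 :: real ^ 'n) = 1"
  by simp

lemma coord_0 [simp]: "coord i f 0 = 0"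
  by (simp add: coord_def)

lemma coord_1: "\<forall>\<^sub>F f in F. coord i f 1 = 1"
  using norm_disp_unit[OF norm_axis_1, of i]
  by eventually_elim (simp add: coord_def norm_eq_1)

lemma coord_add: "\<forall>\<^sub>F f in F. coord i f (x + y) = coord i f x + coord i f y"
  using disp_add[of "x *\<^sub>R axis i 1" "y *\<^sub>R axis i 1"]
  by eventually_elim (simp add: coord_def scaleR_add_left inner_add_left)

lemma coord_sum:
  assumes "finite A"
  shows "\<forall>\<^sub>F f in F. coord i f (\<Sum>a\<in>A. x a) = (\<Sum>a\<in>A. coord i f (x a))"
  using assms
proof (induction A rule: finite_induct)
  case (insert a A)
  from insert.IH coord_add[of i "x a" "\<Sum>a\<in>A. x a"] show ?case
    by eventually_elim (simp add: insert.hyps)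
qed simp

lemma coord_rat_mult: "q \<in> \<rat> \<Longrightarrow> \<forall>\<^sub>F f in F. coord i f (q * x) = q * coord i f x"
  using disp_scaleR_rat[of q "x *\<^sub>R axis i 1"]
  by (auto simp: coord_def elim: eventually_mono)

text \<open>Polarization expresses the inner product by three distances, whose limits are given by
  \<open>lim\<close>.\<close>

lemma tendsto_coord: "((\<lambda>f. coord i f x) \<longlongrightarrow> x) F"
proof -
  let ?e = "axis i 1 :: real ^ 'n"
  have polar: "coord i f x = ((dist (f (x *\<^sub>R ?e)) (f 0))\<^sup>2 + (dist (f ?e) (f 0))\<^sup>2
      - (dist (f (x *\<^sub>R ?e)) (f ?e))\<^sup>2) / 2" for f
  proof -
    have "f (x *\<^sub>R ?e) - f ?e = disp f (x *\<^sub>R ?e) - disp f ?e" by (simp add: disp_def)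
    then show ?thesis
      unfolding coord_def dist_norm by (simp add: disp_def[symmetric] dot_norm_neg)
  qed
  have "dist (x *\<^sub>R ?e) ?e = \<bar>x - 1\<bar>"
    using norm_scaleR[of "x - 1" ?e] by (simp add: dist_norm scaleR_diff_left)
  then have "((dist (x *\<^sub>R ?e) 0)\<^sup>2 + (dist ?e 0)\<^sup>2 - (dist (x *\<^sub>R ?e) ?e)\<^sup>2) / 2 = x"
    by (simp add: power2_eq_square algebra_simps)
  moreover have "((\<lambda>f. coord i f x) \<longlongrightarrow>
      ((dist (x *\<^sub>R ?e) 0)\<^sup>2 + (dist ?e 0)\<^sup>2 - (dist (x *\<^sub>R ?e) ?e)\<^sup>2) / 2) F"
    unfolding polar by (intro tendsto_intros lim) simp
  ultimately show ?thesis by simp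
qed

lemma disp_axis_orthonormal:
  "\<forall>\<^sub>F f in F. \<forall>i j. disp f (axis i 1) \<bullet> disp f (axis j 1) = (if i = j then 1 else 0)"
proof (intro eventually_all_finite)
  fix i j :: 'n
  show "\<forall>\<^sub>F f in F. disp f (axis i 1) \<bullet> disp f (axis j 1) = (if i = j then 1 else 0)"
  proof (cases "i = j")
    case True
    then show ?thesis using coord_1[of i] by (simp add: coord_def)
  next
    case False
    then show ?thesis
      using disp_orthogonal_unit[OF norm_axis_1, of "axis i 1" j] by (simp add: inner_axis_axis)
  qed
qed

text \<open>Without its \<open>j\<close>-th component, \<open>v\<close> is orthogonal to the axis
  vector, and its image remains so.\<close>

lemma disp_inner_axis: "\<forall>\<^sub>F f in F. disp f v \<bullet> disp f (axis j 1) = coord j f (v $ j)"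
proof -
  have "\<forall>\<^sub>F f in F. disp f (v - (v $ j) *\<^sub>R axis j 1) \<bullet> disp f (axis j 1) = 0"
    by (intro disp_orthogonal_unit norm_axis_1) (simp add: inner_diff_left inner_axis)
  with disp_diff[of v "(v $ j) *\<^sub>R axis j 1"] show ?thesis
    by eventually_elim (simp add: coord_def inner_diff_left)
qed

lemma norm_disp_coord: "\<forall>\<^sub>F f in F. (norm (disp f v))\<^sup>2 = (\<Sum>j\<in>UNIV. (coord j f (v $ j))\<^sup>2)"
proof -
  have "\<forall>\<^sub>F f in F. \<forall>j. disp f v \<bullet> disp f (axis j 1) = coord j f (v $ j)"
    by (intro eventually_all_finite disp_inner_axis)
  with disp_axis_orthonormal show ?thesis
  proof eventually_elim
    case (elim f)
    then show ?case
      using orthonormal_parseval[of "\<lambda>j. disp f (axis j 1)" "disp f v"] by simp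
  qed
qed

text \<open>The unit vector \<open>u\<close> must have rational coordinates for rational homogeneity
  to apply, hence 3/5 and 4/5. The orthogonality of \<open>y\<close> to \<open>u\<close> then says
  that 12/25 times the difference of the two coordinate maps at \<open>x\<close> vanishes.\<close>

lemma coord_index: "\<forall>\<^sub>F f in F. coord i f x = coord j f x"
proof (cases "i = j")
  case False
  let ?i = "axis i 1 :: real ^ 'n" and ?j = "axis j 1 :: real ^ 'n"
  have ij: "?i \<bullet> ?i = 1" "?j \<bullet> ?j = 1" "?i \<bullet> ?j = 0" "?j \<bullet> ?i = 0"
    using False by (simp_all add: inner_axis_axis)
  define u where "u = (3 / 5) *\<^sub>R ?i + (4 / 5) *\<^sub>R ?j"
  define y where "y = (4 / 5) *\<^sub>R x *\<^sub>R ?i - (3 / 5) *\<^sub>R x *\<^sub>R ?j"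
  have "u \<bullet> u = 1" "y \<bullet> u = 0"
    by (simp_all add: u_def y_def inner_add_left inner_add_right inner_diff_left ij)
  then have "\<forall>\<^sub>F f in F. disp f y \<bullet> disp f u = 0"
    by (intro disp_orthogonal_unit) (simp_all add: norm_eq_1)
  moreover have "\<forall>\<^sub>F f in F. disp f u = (3 / 5) *\<^sub>R disp f ?i + (4 / 5) *\<^sub>R disp f ?j"
  proof -
    have "\<forall>\<^sub>F f in F. disp f ((3 / 5) *\<^sub>R ?i) = (3 / 5) *\<^sub>R disp f ?i"
      "\<forall>\<^sub>F f in F. disp f ((4 / 5) *\<^sub>R ?j) = (4 / 5) *\<^sub>R disp f ?j"
      by (intro disp_scaleR_rat; simp)+
    with disp_add[of "(3 / 5) *\<^sub>R ?i" "(4 / 5) *\<^sub>R ?j"] show ?thesis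
      unfolding u_def by eventually_elim simp
  qed
  moreover have "\<forall>\<^sub>F f in F. disp f y = (4 / 5) *\<^sub>R disp f (x *\<^sub>R ?i) - (3 / 5) *\<^sub>R disp f (x *\<^sub>R ?j)"
  proof -
    have "\<forall>\<^sub>F f in F. disp f ((4 / 5) *\<^sub>R x *\<^sub>R ?i) = (4 / 5) *\<^sub>R disp f (x *\<^sub>R ?i)"
      "\<forall>\<^sub>F f in F. disp f ((3 / 5) *\<^sub>R x *\<^sub>R ?j) = (3 / 5) *\<^sub>R disp f (x *\<^sub>R ?j)"
      by (intro disp_scaleR_rat; simp)+
    with disp_diff[of "(4 / 5) *\<^sub>R x *\<^sub>R ?i" "(3 / 5) *\<^sub>R x *\<^sub>R ?j"] show ?thesis
      unfolding y_def by eventually_elim simp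
  qed
  moreover have "\<forall>\<^sub>F f in F. disp f (x *\<^sub>R ?i) \<bullet> disp f ?j = 0"
    "\<forall>\<^sub>F f in F. disp f (x *\<^sub>R ?j) \<bullet> disp f ?i = 0"
    using ij by (intro disp_orthogonal_unit norm_axis_1; simp)+
  ultimately show ?thesis
    by eventually_elim (simp add: coord_def inner_diff_left inner_add_right)
qed simp

text \<open>On an axis, inversion is \<open>x \<mapsto> 1 / x\<close>; the image of the axis vector
  has only one nonzero coordinate at most, so its squared norm is
  \<open>(coord i f x)\<^sup>2\<close>.\<close>

lemma coord_inverse:
  assumes "x \<noteq> 0"
  shows "\<forall>\<^sub>F f in F. coord i f (1 / x) = 1 / coord i f x"
proof -
  have v: "x *\<^sub>R axis i 1 \<noteq> (0 :: real ^ 'n)" using assms by (simp add: axis_eq_0_iff)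
  have "(1 / (norm (x *\<^sub>R axis i 1 :: real ^ 'n))\<^sup>2) *\<^sub>R x *\<^sub>R axis i 1 = (1 / x) *\<^sub>R (axis i 1 :: real ^ 'n)"
    using assms by (simp add: power2_eq_square)
  with disp_inversion[OF v]
  have "\<forall>\<^sub>F f in F. disp f ((1 / x) *\<^sub>R axis i 1)
      = (1 / (norm (disp f (x *\<^sub>R axis i 1)))\<^sup>2) *\<^sub>R disp f (x *\<^sub>R axis i 1)" by simp
  with norm_disp_coord[of "x *\<^sub>R axis i 1"] show ?thesis
  proof eventually_elim
    case (elim f)
    have "(coord j f ((x *\<^sub>R axis i 1 :: real ^ 'n) $ j))\<^sup>2 = (if j = i then (coord i f x)\<^sup>2 else 0)" for j
      by (simp add: axis_def)
    then have "(norm (disp f (x *\<^sub>R axis i 1)))\<^sup>2 = (coord i f x)\<^sup>2" using elim(1) by simp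
    then show ?case using elim(2) by (simp add: coord_def[of i f "1 / x"] power2_eq_square flip: coord_def)
  qed
qed

text \<open>Hua's identity \<open>1 / (1 / x - 1 / (x + 1)) = x\<^sup>2 + x\<close> turns inverses into squares.\<close>

lemma coord_square: "\<forall>\<^sub>F f in F. coord i f (x\<^sup>2) = (coord i f x)\<^sup>2"
proof (cases "x = 0 \<or> x = -1")
  case True
  then show ?thesis
    using coord_1[of i] coord_rat_mult[of "-1" i 1] by (auto elim: eventually_elim2)
next
  case False
  then have "x \<noteq> 0" "x + 1 \<noteq> 0" by (auto simp: add_eq_0_iff2)
  moreover have "x\<^sup>2 + x = x * (x + 1)" by (simp add: power2_eq_square algebra_simps)
  ultimately have x: "x \<noteq> 0" "x + 1 \<noteq> 0" "x\<^sup>2 + x \<noteq> 0" by simp_all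
  have hua: "1 / (x\<^sup>2 + x) + 1 / (x + 1) = 1 / x"
    using x by (simp add: divide_simps) (simp add: power2_eq_square algebra_simps)
  have nz: "\<forall>\<^sub>F f in F. coord i f y \<noteq> 0" if "y \<noteq> 0" for y
    using tendsto_imp_eventually_ne[OF tendsto_coord that] .
  from coord_inverse[OF x(1), of i] coord_inverse[OF x(2), of i] coord_inverse[OF x(3), of i]
    nz[OF x(1)] nz[OF x(2)] nz[OF x(3)]
    coord_add[of i "1 / (x\<^sup>2 + x)" "1 / (x + 1)"] coord_add[of i x 1] coord_add[of i "x\<^sup>2" x] coord_1[of i]
  show ?thesis
  proof eventually_elim
    case (elim f)
    define g where "g = coord i f x"
    have g: "g \<noteq> 0" "g + 1 \<noteq> 0" "coord i f (x\<^sup>2) + g \<noteq> 0" using elim by (simp_all add: g_def)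
    have "1 / g = 1 / (coord i f (x\<^sup>2) + g) + 1 / (g + 1)"
      using elim unfolding hua by (simp add: g_def)
    then have "coord i f (x\<^sup>2) + g = g\<^sup>2 + g" using g
      by (simp add: divide_simps) (simp add: power2_eq_square algebra_simps)
    then show ?case by (simp add: g_def)
  qed
qed

text \<open>Polarization of \<open>coord_square\<close>: compare the square of \<open>x + y\<close>
  with its expansion.\<close>

lemma coord_mult: "\<forall>\<^sub>F f in F. coord i f (x * y) = coord i f x * coord i f y"
proof -
  have "(x + y)\<^sup>2 = (x\<^sup>2 + y\<^sup>2) + 2 * (x * y)" by (simp add: power2_sum)
  with coord_square[of i "x + y"]
  have "\<forall>\<^sub>F f in F. coord i f ((x\<^sup>2 + y\<^sup>2) + 2 * (x * y)) = (coord i f (x + y))\<^sup>2" by simp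
  moreover have "\<forall>\<^sub>F f in F. coord i f (2 * (x * y)) = 2 * coord i f (x * y)"
    by (rule coord_rat_mult) simp
  moreover note coord_square[of i x] coord_square[of i y] coord_add[of i x y]
    coord_add[of i "x\<^sup>2" "y\<^sup>2"] coord_add[of i "x\<^sup>2 + y\<^sup>2" "2 * (x * y)"]
  ultimately show ?thesis
    by eventually_elim (simp add: power2_sum)
qed

text \<open>Parseval's identity with all coordinate maps replaced by the one of index
  \<open>i\<close>; being additive and compatible with squares, it can be pulled out of the
  sum.\<close>

lemma norm_disp_eq_coord: "\<forall>\<^sub>F f in F. (norm (disp f v))\<^sup>2 = coord i f ((norm v)\<^sup>2)"
proof -
  have v: "(norm v)\<^sup>2 = (\<Sum>j\<in>UNIV. (v $ j)\<^sup>2)"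
    unfolding power2_norm_eq_inner inner_vec_def by (simp add: power2_eq_square)
  have "\<forall>\<^sub>F f in F. \<forall>j. coord j f (v $ j) = coord i f (v $ j)"
    "\<forall>\<^sub>F f in F. \<forall>j. coord i f ((v $ j)\<^sup>2) = (coord i f (v $ j))\<^sup>2"
    by (intro eventually_all_finite coord_index coord_square)+
  with norm_disp_coord[of v] coord_sum[OF finite, of i "\<lambda>j. (v $ j)\<^sup>2" UNIV] show ?thesis
    unfolding v by eventually_elim simp
qed

lemma coord_poly:
  assumes "\<And>k. coeff p k \<in> \<int>"
  shows "\<forall>\<^sub>F f in F. coord i f (poly p x) = poly p (coord i f x)"
  using assms
proof (induction p)
  case (pCons a p)
  have "coeff p k \<in> \<int>" for k using pCons.prems[of "Suc k"] by simp
  note IH = pCons.IH[OF this]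
  have "a \<in> \<rat>" using pCons.prems[of 0] Ints_subset_Rats by auto
  from coord_rat_mult[OF this, of i 1] coord_1[of i] IH coord_mult[of i x "poly p x"]
    coord_add[of i a "x * poly p x"]
  show ?case by eventually_elim simp
qed simp

lemma coord_algebraic:
  assumes "algebraic x"
  shows "\<forall>\<^sub>F f in F. coord i f x = x"
proof -
  obtain p where p: "\<And>k. coeff p k \<in> \<int>" "p \<noteq> 0" "poly p x = 0"
    using assms by (auto simp: algebraic_def)
  let ?R = "{y. poly p y = 0} - {x}"
  \<comment> \<open>The other roots form a finite, hence closed set, so convergence to
    \<open>x\<close> eventually avoids them.\<close>
  have "open (- ?R)" using poly_roots_finite[OF p(2)] by (intro open_Compl finite_imp_closed) auto
  then have "\<forall>\<^sub>F f in F. coord i f x \<in> - ?R" by (rule topological_tendstoD[OF tendsto_coord]) simp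
  with coord_poly[OF p(1), of i x] show ?thesis
    by eventually_elim (auto simp: p(3))
qed

theorem eventually_dist_algebraic:
  assumes "algebraic (dist X Y)"
  shows "\<forall>\<^sub>F f in F. dist (f X) (f Y) = dist X Y"
proof -
  obtain i :: 'n where True by simp
  \<comment> \<open>The algebraic number is the distance itself, so \<open>coord_square\<close>
    leads from its square back to it.\<close>
  from dist_eq_norm_disp[of X Y] norm_disp_eq_coord[of "X - Y" i]
    coord_square[of i "norm (X - Y)"] coord_algebraic[OF assms, of i]
  show ?thesis by eventually_elim (simp add: dist_norm)
qed

theorem eventually_dist_eq:
  assumes "dist K L = dist M N"
  shows "\<forall>\<^sub>F f in F. dist (f K) (f L) = dist (f M) (f N)"
proof -
  obtain i :: 'n where True by simp
  have e: "norm (K - L) = norm (M - N)" using assms by (simp add: dist_norm)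
  from dist_eq_norm_disp[of K L] dist_eq_norm_disp[of M N]
    norm_disp_eq_coord[of "K - L" i] norm_disp_eq_coord[of "M - N" i]
  show ?thesis
    by eventually_elim (metis e norm_ge_zero power2_eq_imp_eq)
qed

end

section \<open>The filter of finite configurations and the theorem\<close>

definition unit_dist_filter :: "('a::metric_space \<Rightarrow> 'a) filter" where
  "unit_dist_filter = (INF S\<in>{S. finite S}. principal {f. unit_dist_preserving_on S f})"

lemma unit_dist_preserving_on_subset:
  "unit_dist_preserving_on S f \<Longrightarrow> A \<subseteq> S \<Longrightarrow> unit_dist_preserving_on A f"
  by (auto simp: unit_dist_preserving_on_def)

text \<open>The principal filters are directed: the union of two finite sets serves for both, so a
  single finite set witnesses each eventual property.\<close>

lemma eventually_unit_dist_filter: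
  "eventually P unit_dist_filter \<longleftrightarrow> (\<exists>S. finite S \<and> (\<forall>f. unit_dist_preserving_on S f \<longrightarrow> P f))"
  unfolding unit_dist_filter_def
proof (subst eventually_INF_base)
  fix A B :: "'a set" assume "A \<in> {S. finite S}" "B \<in> {S. finite S}"
  then show "\<exists>S\<in>{S. finite S}. principal {f. unit_dist_preserving_on S f}
      \<le> inf (principal {f. unit_dist_preserving_on A f}) (principal {f. unit_dist_preserving_on B f})"
    by (intro bexI[of _ "A \<union> B"]) (auto intro: unit_dist_preserving_on_subset)
qed (auto simp: eventually_principal)

text \<open>Each tolerance is half the gap to the value to be excluded: \<open>dist P Q / 2\<close>
  keeps the image distance away from 0, and \<open>\<bar>dist P Q - 1\<bar> / 2\<close> keeps it
  away from 1.\<close>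

lemma unit_dist_preserving_on_tilde:
  assumes T: "\<And>P Q \<epsilon>. \<epsilon> > 0 \<Longrightarrow> unit_dist_preserving_on (T P Q \<epsilon>) f \<Longrightarrow>
           \<bar>dist (f P) (f Q) - dist P Q\<bar> \<le> \<epsilon>"
    and f: "unit_dist_preserving_on (tilde T S) f"
  shows "inj_on f S \<and> unit_dist_iff_on S f"
proof
  show "inj_on f S"
  proof (rule inj_onI, rule ccontr)
    fix P Q assume PQ: "P \<in> S" "Q \<in> S" "f P = f Q" "P \<noteq> Q"
    then have "T P Q (dist P Q / 2) \<subseteq> tilde T S" by (auto simp: tilde_def)
    then show False
      using T[of "dist P Q / 2" P Q] unit_dist_preserving_on_subset[OF f] PQ by simp
  qed
  have "dist P Q = 1" if PQ: "P \<in> S" "Q \<in> S" "dist (f P) (f Q) = 1" for P Q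
  proof (rule ccontr)
    assume ne: "dist P Q \<noteq> 1"
    then have "T P Q (\<bar>dist P Q - 1\<bar> / 2) \<subseteq> tilde T S" using PQ by (auto simp: tilde_def)
    then show False
      using T[of "\<bar>dist P Q - 1\<bar> / 2" P Q] unit_dist_preserving_on_subset[OF f] PQ ne
      by (simp add: abs_minus_commute)
  qed
  moreover have "unit_dist_preserving_on S f"
    by (rule unit_dist_preserving_on_subset[OF f]) (auto simp: tilde_def)
  ultimately show "unit_dist_iff_on S f"
    by (auto simp: unit_dist_iff_on_def unit_dist_preserving_on_def)
qed

theorem theorem2:
  fixes T :: "real ^ 'n \<Rightarrow> real ^ 'n \<Rightarrow> real \<Rightarrow> (real ^ 'n) set"
  assumes "CARD('n) > 1"
    and "\<And>P Q \<epsilon>. \<epsilon> > 0 \<Longrightarrow> finite (T P Q \<epsilon>)"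
    and "\<And>P Q \<epsilon>. \<epsilon> > 0 \<Longrightarrow> {P, Q} \<subseteq> T P Q \<epsilon>"
    and "\<And>P Q \<epsilon> f. \<epsilon> > 0 \<Longrightarrow> unit_dist_preserving_on (T P Q \<epsilon>) f \<Longrightarrow>
           \<bar>dist (f P) (f Q) - dist P Q\<bar> \<le> \<epsilon>"
  shows "(\<forall>(X :: real ^ 'n) Y S. {X, Y} \<subseteq> S \<and> weak_star S X Y \<longrightarrow> star (tilde T S) X Y)
       \<and> (\<forall>(X :: real ^ 'n) Y. algebraic (dist X Y) \<longrightarrow>
            (\<exists>S. finite S \<and> {X, Y} \<subseteq> S \<and> star S X Y))
       \<and> (\<forall>(K :: real ^ 'n) L M N C. {K, L, M, N} \<subseteq> C \<and> weak_diamond C K L M N \<longrightarrow>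
            diamond (tilde T C) K L M N)
       \<and> (\<forall>(K :: real ^ 'n) L M N. dist K L = dist M N \<longrightarrow>
            (\<exists>C. finite C \<and> {K, L, M, N} \<subseteq> C \<and> diamond C K L M N))"
proof -
  interpret beckman_quarles_limit "unit_dist_filter :: (real ^ 'n \<Rightarrow> real ^ 'n) filter"
  proof
    show "CARD('n) > 1" by fact
    show "\<forall>\<^sub>F f in unit_dist_filter. dist (f P) (f Q) = 1" if "dist P Q = 1" for P Q :: "real ^ 'n"
      unfolding eventually_unit_dist_filter
      using that by (intro exI[of _ "{P, Q}"]) (auto simp: unit_dist_preserving_on_def)
    show "((\<lambda>f. dist (f P) (f Q)) \<longlongrightarrow> dist P Q) unit_dist_filter" for P Q :: "real ^ 'n"
    proof (rule tendstoI)
      fix \<epsilon> :: real assume \<epsilon>: "\<epsilon> > 0"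
      \<comment> \<open>The set for tolerance \<open>\<epsilon> / 2\<close> turns the weak bound
        into a strict one.\<close>
      then have "dist (dist (f P) (f Q)) (dist P Q) < \<epsilon>"
        if "unit_dist_preserving_on (T P Q (\<epsilon> / 2)) f" for f
        using assms(4)[OF _ that] by (simp add: dist_real_def)
      then show "\<forall>\<^sub>F f in unit_dist_filter. dist (dist (f P) (f Q)) (dist P Q) < \<epsilon>"
        unfolding eventually_unit_dist_filter
        using assms(2)[of "\<epsilon> / 2" P Q] \<epsilon> by (intro exI[of _ "T P Q (\<epsilon> / 2)"]) auto
    qed
  qed
  have tilde: "inj_on f S \<and> unit_dist_iff_on S f" if "unit_dist_preserving_on (tilde T S) f" for S f
    by (rule unit_dist_preserving_on_tilde[OF assms(4) that])
  show ?thesis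
  proof (intro conjI allI impI)
    fix X Y :: "real ^ 'n" and S assume "{X, Y} \<subseteq> S \<and> weak_star S X Y"
    then show "star (tilde T S) X Y"
      using tilde by (auto simp: star_def weak_star_def)
  next
    fix X Y :: "real ^ 'n" assume "algebraic (dist X Y)"
    from eventually_dist_algebraic[OF this] obtain S where "finite S"
      "\<And>f. unit_dist_preserving_on S f \<Longrightarrow> dist (f X) (f Y) = dist X Y"
      unfolding eventually_unit_dist_filter by blast
    \<comment> \<open>The witness for the eventual property may miss \<open>X\<close> and
      \<open>Y\<close>; enlarging it only strengthens the hypothesis on \<open>f\<close>.\<close>
    then show "\<exists>S. finite S \<and> {X, Y} \<subseteq> S \<and> star S X Y"
      unfolding star_def
      by (intro exI[of _ "S \<union> {X, Y}"]) (blast intro: unit_dist_preserving_on_subset)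
  next
    fix K L M N :: "real ^ 'n" and C assume "{K, L, M, N} \<subseteq> C \<and> weak_diamond C K L M N"
    then show "diamond (tilde T C) K L M N"
      using tilde by (auto simp: diamond_def weak_diamond_def)
  next
    fix K L M N :: "real ^ 'n" assume "dist K L = dist M N"
    from eventually_dist_eq[OF this] obtain C where "finite C"
      "\<And>f. unit_dist_preserving_on C f \<Longrightarrow> dist (f K) (f L) = dist (f M) (f N)"
      unfolding eventually_unit_dist_filter by blast
    then show "\<exists>C. finite C \<and> {K, L, M, N} \<subseteq> C \<and> diamond C K L M N"
      unfolding diamond_def
      by (intro exI[of _ "C \<union> {K, L, M, N}"]) (blast intro: unit_dist_preserving_on_subset)
  qed
qed

end
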